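(* Let $(X,\mathcal{A},\lambda)$ and $(X',\mathcal{A}',\lambda')$ be $\sigma$-finite measure spaces and $T:X\to X'$ a null-preserving map. Then the following hold for every $A\in\mathcal{A}$, where $TA:=\{Tx:x\in A\}$ denotes the set-theoretic image. (i) If $TA\subseteq A'\in\mathcal{A}'$, then $\hat{T}A\overset{.}{\subseteq}A'$. (ii) In particular, if $TA\in\mathcal{A}'$, then $\hat{T}A\overset{.}{\subseteq}TA$. (iii) Moreover, if $TA\in\mathcal{A}'$, then there is some $A_\circ\in\mathcal{A}$ with $A_\circ\subseteq A$ such that $A_\circ\overset{.}{=}A$ and $TA_\circ\in\mathcal{A}'$ with $\hat{T}A\overset{.}{=}\hat{T}A_\circ\overset{.}{=}TA_\circ$. (iv) If $T$ has measurable images and no ambitious null-sets, then $\hat{T}A\overset{.}{=}TA$.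
   Context: For $A,B\in\mathcal{A}$ write $A\overset{.}{\subseteq}B$ if $\lambda(A\setminus B)=0$ and $A\overset{.}{=}B$ if $\lambda(A\triangle B)=0$; similarly in $X'$ with $\lambda'$. A measurable map $T:X\to X'$ is null-preserving if $\lambda'(A')=0$ implies $\lambda(T^{-1}A')=0$ for $A'\in\mathcal{A}'$. An essential image of $A\in\mathcal{A}$ under $T$ is a set $A'\in\mathcal{A}'$ such that $T^{-1}A'\overset{.}{\supseteq}A$ and such that every $B'\in\mathcal{A}'$ with $T^{-1}B'\overset{.}{\supseteq}A$ satisfies $B'\overset{.}{\supseteq}A'$. In the present ($\sigma$-finite, null-preserving) setting every $A\in\mathcal{A}$ has essential images and they form exactly one equivalence class under $\overset{.}{=}$; $\hat{T}A$ denotes an arbitrary fixed essential image of $A$. $T$ has measurable images if $A\in\mathcal{A}$ implies $TA\in\mathcal{A}'$. An ambitious null-set for $T$ is a set $A\in\mathcal{A}$ with $\lambda(A)=0$, $TA\in\mathcal{A}'$ and $\lambda'(TA)>0$. *)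

theory Defs
  imports "HOL-Analysis.Analysis"
begin

text \<open>
  Inclusion and equality modulo null sets are only meant for measurable sets; since \<open>emeasure\<close>
  is \<open>0\<close> on non-measurable sets, measurability is made part of the relations.
\<close>

definition ess_subset :: "'a measure \<Rightarrow> 'a set \<Rightarrow> 'a set \<Rightarrow> bool" where
  "ess_subset M A B \<longleftrightarrow> A \<in> sets M \<and> B \<in> sets M \<and> emeasure M (A - B) = 0"

definition ess_eq :: "'a measure \<Rightarrow> 'a set \<Rightarrow> 'a set \<Rightarrow> bool" where
  "ess_eq M A B \<longleftrightarrow> A \<in> sets M \<and> B \<in> sets M \<and> emeasure M (sym_diff A B) = 0"

definition null_preserving :: "'a measure \<Rightarrow> 'b measure \<Rightarrow> ('a \<Rightarrow> 'b) \<Rightarrow> bool" where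
  "null_preserving M M' T \<longleftrightarrow>
     T \<in> measurable M M' \<and>
     (\<forall>A'\<in>sets M'. emeasure M' A' = 0 \<longrightarrow> emeasure M (T -` A' \<inter> space M) = 0)"

definition essential_image ::
    "'a measure \<Rightarrow> 'b measure \<Rightarrow> ('a \<Rightarrow> 'b) \<Rightarrow> 'a set \<Rightarrow> 'b set \<Rightarrow> bool" where
  "essential_image M M' T A A' \<longleftrightarrow>
     A' \<in> sets M' \<and>
     ess_subset M A (T -` A' \<inter> space M) \<and>
     (\<forall>B'\<in>sets M'. ess_subset M A (T -` B' \<inter> space M) \<longrightarrow> ess_subset M' A' B')"

definition measurable_images :: "'a measure \<Rightarrow> 'b measure \<Rightarrow> ('a \<Rightarrow> 'b) \<Rightarrow> bool" where
  "measurable_images M M' T \<longleftrightarrow> (\<forall>A\<in>sets M. T ` A \<in> sets M')"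

definition ambitious_null_set ::
    "'a measure \<Rightarrow> 'b measure \<Rightarrow> ('a \<Rightarrow> 'b) \<Rightarrow> 'a set \<Rightarrow> bool" where
  "ambitious_null_set M M' T A \<longleftrightarrow>
     A \<in> sets M \<and> emeasure M A = 0 \<and> T ` A \<in> sets M' \<and> emeasure M' (T ` A) > 0"

text \<open>
  In the \<open>\<sigma>\<close>-finite, null-preserving setting essential images exist and are unique modulo null
  sets, so that a choice of an essential image for every measurable set is always available.
\<close>

lemma essential_image_exists:
  assumes "sigma_finite_measure M" and "sigma_finite_measure M'"
    and T: "null_preserving M M' T" and A: "A \<in> sets M"
  shows "\<exists>A'. essential_image M M' T A A'"
proof -
  interpret M: sigma_finite_measure M by fact
  interpret M': sigma_finite_measure M' by fact
  have Tm[measurable]: "T \<in> measurable M M'" using T by (simp add: null_preserving_def)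
  note A[measurable]
  obtain h where h[measurable]: "h \<in> borel_measurable M" and hfin: "integral\<^sup>N M h \<noteq> \<infinity>"
    and hpos: "\<forall>x\<in>space M. 0 < h x \<and> h x < \<infinity>"
    using M.Ex_finite_integrable_function by blast
  define N where "N = distr (density M (\<lambda>x. h x * indicator A x)) M' T"
  have setsN: "sets N = sets M'" by (simp add: N_def)
  have N0: "emeasure N B = 0 \<longleftrightarrow> emeasure M (A \<inter> (T -` B \<inter> space M)) = 0"
    if B[measurable]: "B \<in> sets M'" for B
  proof -
    have "emeasure N B = (\<integral>\<^sup>+x. h x * indicator A x * indicator (T -` B \<inter> space M) x \<partial>M)"
      by (simp add: N_def emeasure_distr emeasure_density)
    then have "emeasure N B = 0 \<longleftrightarrow>
        (AE x in M. h x * indicator A x * indicator (T -` B \<inter> space M) x = 0)"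
      by (simp add: nn_integral_0_iff_AE)
    also have "\<dots> \<longleftrightarrow> (AE x in M. x \<notin> A \<inter> (T -` B \<inter> space M))"
      using hpos by (intro AE_cong) (auto simp: indicator_def)
    also have "\<dots> \<longleftrightarrow> emeasure M (A \<inter> (T -` B \<inter> space M)) = 0"
      by (subst AE_iff_null_sets[symmetric]) (auto simp: null_sets_def)
    finally show ?thesis .
  qed
  have ac: "absolutely_continuous M' N"
  proof -
    have "emeasure N B = 0" if "B \<in> null_sets M'" for B
    proof -
      have B: "B \<in> sets M'" "emeasure M' B = 0" using that by auto
      then have "emeasure M (T -` B \<inter> space M) = 0"
        using T by (simp add: null_preserving_def)
      moreover have "emeasure M (A \<inter> (T -` B \<inter> space M)) \<le> emeasure M (T -` B \<inter> space M)"
        using B by (intro emeasure_mono) auto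
      ultimately show ?thesis using N0 B by simp
    qed
    then show ?thesis by (auto simp: absolutely_continuous_def null_sets_def setsN)
  qed
  obtain f where f[measurable]: "f \<in> borel_measurable M'" and dens: "density M' f = N"
    using M'.Radon_Nikodym[OF ac setsN] by blast
  define A' where "A' = {x \<in> space M'. f x \<noteq> 0}"
  have A'[measurable]: "A' \<in> sets M'" by (simp add: A'_def)
  have N0': "emeasure N B = 0 \<longleftrightarrow> emeasure M' (A' \<inter> B) = 0"
    if B[measurable]: "B \<in> sets M'" for B
  proof -
    have "emeasure N B = (\<integral>\<^sup>+x. f x * indicator B x \<partial>M')"
      by (simp add: dens[symmetric] emeasure_density)
    then have "emeasure N B = 0 \<longleftrightarrow> (AE x in M'. f x * indicator B x = 0)"
      by (simp add: nn_integral_0_iff_AE)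
    also have "\<dots> \<longleftrightarrow> (AE x in M'. x \<notin> A' \<inter> B)"
      by (intro AE_cong) (auto simp: indicator_def A'_def)
    also have "\<dots> \<longleftrightarrow> emeasure M' (A' \<inter> B) = 0"
      by (subst AE_iff_null_sets[symmetric]) (auto simp: null_sets_def)
    finally show ?thesis .
  qed
  have key: "emeasure M (A - (T -` B \<inter> space M)) = 0 \<longleftrightarrow> emeasure M' (A' - B) = 0"
    if B: "B \<in> sets M'" for B
  proof -
    have "A - (T -` B \<inter> space M) = A \<inter> (T -` (space M' - B) \<inter> space M)"
      using sets.sets_into_space[OF A] measurable_space[OF Tm] by auto
    moreover have "A' - B = A' \<inter> (space M' - B)"
      using sets.sets_into_space[OF A'] by auto
    ultimately show ?thesis
      using N0[of "space M' - B"] N0'[of "space M' - B"] B by auto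
  qed
  have "essential_image M M' T A A'"
    using key[OF A'] key by (auto simp: essential_image_def ess_subset_def)
  then show ?thesis ..
qed

lemma essential_image_unique:
  assumes "essential_image M M' T A A'" and "essential_image M M' T A B'"
  shows "ess_eq M' A' B'"
proof -
  have "ess_subset M' A' B'" "ess_subset M' B' A'"
    using assms by (auto simp: essential_image_def)
  then have "A' - B' \<in> null_sets M'" "B' - A' \<in> null_sets M'" "A' \<in> sets M'" "B' \<in> sets M'"
    by (auto simp: ess_subset_def null_sets_def)
  then show ?thesis
    using null_sets.Un[of "A' - B'" M' "B' - A'"] by (auto simp: ess_eq_def null_sets_def)
qed

end

theory Submission
  imports Defs
begin

text \<open>
  The part of \<open>A\<close> that \<open>T\<close> maps into an essential image \<open>A'\<close>, namely \<open>A\<^sub>0 = A \<inter> T -` A'\<close>, has full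
  measure in \<open>A\<close>, and its image is \<open>T ` A \<inter> A'\<close>. As \<open>A'\<close> is essentially contained in \<open>T ` A\<close>, this
  image is essentially \<open>A'\<close>. The remaining part of \<open>T ` A\<close> lies in the image of the null set
  \<open>A - A\<^sub>0\<close>, which is null unless \<open>A - A\<^sub>0\<close> is ambitious.
\<close>

lemma ess_subset_iff_null_sets:
  "ess_subset M A B \<longleftrightarrow> A \<in> sets M \<and> B \<in> sets M \<and> A - B \<in> null_sets M"
  by (auto simp: ess_subset_def null_sets_def)

text \<open>The symmetric difference is null exactly when both of its halves are. This reduces
  symmetry and transitivity of \<open>ess_eq\<close> to facts about the preorder
  \<open>ess_subset\<close>.\<close>

lemma ess_eq_iff_ess_subset: "ess_eq M A B \<longleftrightarrow> ess_subset M A B \<and> ess_subset M B A"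
proof
  assume "ess_eq M A B"
  then have AB: "A \<in> sets M" "B \<in> sets M" and null: "sym_diff A B \<in> null_sets M"
    by (auto simp: ess_eq_def null_sets_def)
  have "A - B \<in> null_sets M" "B - A \<in> null_sets M"
    using AB by (auto intro: null_sets_subset[OF null])
  then show "ess_subset M A B \<and> ess_subset M B A"
    using AB by (simp add: ess_subset_iff_null_sets)
next
  assume "ess_subset M A B \<and> ess_subset M B A"
  then show "ess_eq M A B"
    using null_sets.Un[of "A - B" M "B - A"]
    by (auto simp: ess_subset_iff_null_sets ess_eq_def)
qed

lemma ess_subset_trans:
  assumes "ess_subset M A B" and "ess_subset M B C"
  shows "ess_subset M A C"
proof -
  have "(A - B) \<union> (B - C) \<in> null_sets M" "A \<in> sets M" "C \<in> sets M"
    using assms by (auto simp: ess_subset_iff_null_sets)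
  \<comment> \<open>A point of \<open>A - C\<close> leaves either \<open>B\<close> or, being in
    \<open>B\<close>, leaves \<open>C\<close>.\<close>
  then have "A - C \<in> null_sets M"
    by (auto intro: null_sets_subset)
  with \<open>A \<in> sets M\<close> \<open>C \<in> sets M\<close> show ?thesis
    by (simp add: ess_subset_iff_null_sets)
qed

lemma subset_imp_ess_subset:
  "A \<in> sets M \<Longrightarrow> B \<in> sets M \<Longrightarrow> A \<subseteq> B \<Longrightarrow> ess_subset M A B"
  by (simp add: ess_subset_def Diff_eq_empty_iff[THEN iffD2])

text \<open>\<open>A\<close> enters the definition of \<open>essential_image\<close> only through
  \<open>ess_subset M A\<close>, a predicate that does not change when \<open>A\<close> is altered
  by a null set.\<close>

lemma essential_image_cong:
  assumes "essential_image M M' T A A'" and "ess_eq M B A"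
  shows "essential_image M M' T B A'"
proof -
  have "ess_subset M B C \<longleftrightarrow> ess_subset M A C" for C
    using assms(2) by (auto simp: ess_eq_iff_ess_subset intro: ess_subset_trans)
  with assms(1) show ?thesis
    by (simp add: essential_image_def)
qed

text \<open>The hypothesis on the image puts \<open>A\<close> inside the preimage of
  \<open>B\<close>, so \<open>B\<close> competes in the minimality clause that defines
  \<open>A'\<close>.\<close>

lemma essential_image_ess_subset:
  assumes T: "T \<in> measurable M M'" and A: "A \<in> sets M" and im: "essential_image M M' T A A'"
    and B: "B \<in> sets M'" and sub: "T ` A \<subseteq> B"
  shows "ess_subset M' A' B"
proof -
  have "ess_subset M A (T -` B \<inter> space M)"
    using A sub sets.sets_into_space[OF A] measurable_sets[OF T B]
    by (intro subset_imp_ess_subset) auto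
  with im B show ?thesis
    by (simp add: essential_image_def)
qed

text \<open>The discarded part of \<open>A\<close> lies outside the preimage of \<open>A'\<close>,
  and the covering clause of \<open>essential_image\<close> says that this part is null.\<close>

lemma ess_eq_Int_vimage_essential_image:
  assumes "essential_image M M' T A A'"
  shows "ess_eq M (A \<inter> (T -` A' \<inter> space M)) A"
proof -
  let ?P = "T -` A' \<inter> space M"
  have "ess_subset M A ?P"
    using assms by (simp add: essential_image_def)
  moreover have "A - A \<inter> ?P = A - ?P"
    by blast
  ultimately have "ess_subset M A (A \<inter> ?P)"
    by (auto simp: ess_subset_def)
  moreover from this have "ess_subset M (A \<inter> ?P) A"
    by (intro subset_imp_ess_subset) (auto simp: ess_subset_def)
  ultimately show ?thesis
    by (simp add: ess_eq_iff_ess_subset)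
qed

lemma ess_eq_essential_image_Int_image:
  assumes T: "T \<in> measurable M M'" and A: "A \<in> sets M" and im: "essential_image M M' T A A'"
    and TA: "T ` A \<in> sets M'"
  shows "ess_eq M' A' (T ` A \<inter> A')"
proof -
  have A': "A' \<in> sets M'"
    using im by (simp add: essential_image_def)
  have "ess_subset M' A' (T ` A)"
    by (rule essential_image_ess_subset[OF T A im TA order_refl])
  moreover have "A' - T ` A \<inter> A' = A' - T ` A"
    by blast
  ultimately have "ess_subset M' A' (T ` A \<inter> A')"
    using A' TA by (simp add: ess_subset_def)
  then show ?thesis
    using A' TA by (auto simp: ess_eq_iff_ess_subset intro: subset_imp_ess_subset)
qed

lemma ess_eq_essential_image_image:
  assumes T: "T \<in> measurable M M'" and A: "A \<in> sets M" and im: "essential_image M M' T A A'"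
    and meas: "measurable_images M M' T" and amb: "\<nexists>N. ambitious_null_set M M' T N"
  shows "ess_eq M' A' (T ` A)"
proof -
  let ?N = "A - (T -` A' \<inter> space M)"
  have A': "A' \<in> sets M'" and N: "?N \<in> sets M" "emeasure M ?N = 0"
    using im by (auto simp: essential_image_def ess_subset_def)
  have TA: "T ` A \<in> sets M'" and TN: "T ` ?N \<in> sets M'"
    using meas A N(1) by (auto simp: measurable_images_def)
  \<comment> \<open>\<open>?N\<close> is null and its image is measurable, so an image of positive
    measure would make \<open>?N\<close> ambitious.\<close>
  have "emeasure M' (T ` ?N) = 0"
    using amb N TN by (auto simp: ambitious_null_set_def)
  then have "T ` ?N \<in> null_sets M'"
    using TN by (simp add: null_sets_def)
  \<comment> \<open>If \<open>x\<close> is in \<open>A\<close> and \<open>T x\<close> misses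
    \<open>A'\<close>, then \<open>x\<close> misses the preimage of \<open>A'\<close>.\<close>
  moreover have "T ` A - A' \<subseteq> T ` ?N"
    by auto
  ultimately have "ess_subset M' (T ` A) A'"
    using A' TA by (auto simp: ess_subset_iff_null_sets intro: null_sets_subset)
  then show ?thesis
    using essential_image_ess_subset[OF T A im TA] by (simp add: ess_eq_iff_ess_subset)
qed

theorem theorem3p3:
  fixes M :: "'a measure" and M' :: "'b measure" and T :: "'a \<Rightarrow> 'b"
    and That :: "'a set \<Rightarrow> 'b set"
  assumes "sigma_finite_measure M" and "sigma_finite_measure M'"
    and "null_preserving M M' T"
    and "\<And>A. A \<in> sets M \<Longrightarrow> essential_image M M' T A (That A)"
  shows "\<forall>A\<in>sets M.
      (\<forall>A'\<in>sets M'. T ` A \<subseteq> A' \<longrightarrow> ess_subset M' (That A) A') \<and>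
      (T ` A \<in> sets M' \<longrightarrow> ess_subset M' (That A) (T ` A)) \<and>
      (T ` A \<in> sets M' \<longrightarrow>
        (\<exists>A\<^sub>0\<in>sets M. A\<^sub>0 \<subseteq> A \<and> ess_eq M A\<^sub>0 A \<and> T ` A\<^sub>0 \<in> sets M' \<and>
          ess_eq M' (That A) (That A\<^sub>0) \<and> ess_eq M' (That A\<^sub>0) (T ` A\<^sub>0))) \<and>
      (measurable_images M M' T \<and> \<not> (\<exists>N. ambitious_null_set M M' T N) \<longrightarrow>
        ess_eq M' (That A) (T ` A))"
proof (intro ballI conjI impI)
  have T: "T \<in> measurable M M'"
    using assms(3) by (simp add: null_preserving_def)
  fix A assume A: "A \<in> sets M"
  have im: "essential_image M M' T A (That A)"
    by (rule assms(4)[OF A])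
  show "ess_subset M' (That A) A'" if "A' \<in> sets M'" "T ` A \<subseteq> A'" for A'
    by (rule essential_image_ess_subset[OF T A im that])
  show "ess_subset M' (That A) (T ` A)" if "T ` A \<in> sets M'"
    by (rule essential_image_ess_subset[OF T A im that order_refl])
  show "ess_eq M' (That A) (T ` A)"
    if "measurable_images M M' T \<and> \<not> (\<exists>N. ambitious_null_set M M' T N)"
    using that ess_eq_essential_image_image[OF T A im] by blast
  show "\<exists>A\<^sub>0\<in>sets M. A\<^sub>0 \<subseteq> A \<and> ess_eq M A\<^sub>0 A \<and> T ` A\<^sub>0 \<in> sets M' \<and>
          ess_eq M' (That A) (That A\<^sub>0) \<and> ess_eq M' (That A\<^sub>0) (T ` A\<^sub>0)"
    if TA: "T ` A \<in> sets M'"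
  proof -
    define A\<^sub>0 where "A\<^sub>0 = A \<inter> (T -` That A \<inter> space M)"
    have eq: "ess_eq M A\<^sub>0 A"
      unfolding A\<^sub>0_def by (rule ess_eq_Int_vimage_essential_image[OF im])
    then have A\<^sub>0: "A\<^sub>0 \<in> sets M"
      by (simp add: ess_eq_def)
    \<comment> \<open>\<open>That A\<close> is also an essential image of \<open>A\<^sub>0\<close>,
      which differs from \<open>A\<close> by a null set. Uniqueness then compares it with the chosen
      \<open>That A\<^sub>0\<close>.\<close>
    have That_eq: "ess_eq M' (That A) (That A\<^sub>0)"
      by (rule essential_image_unique[OF essential_image_cong[OF im eq] assms(4)[OF A\<^sub>0]])
    have "T ` A\<^sub>0 = T ` A \<inter> That A"
      using sets.sets_into_space[OF A] by (auto simp: A\<^sub>0_def)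
    then have T_eq: "ess_eq M' (That A) (T ` A\<^sub>0)"
      using ess_eq_essential_image_Int_image[OF T A im TA] by simp
    \<comment> \<open>Both sets are essentially equal to \<open>That A\<close>.\<close>
    have "ess_eq M' (That A\<^sub>0) (T ` A\<^sub>0)"
      using That_eq T_eq by (auto simp: ess_eq_iff_ess_subset intro: ess_subset_trans)
    moreover have "A\<^sub>0 \<subseteq> A" "T ` A\<^sub>0 \<in> sets M'"
      using T_eq by (auto simp: A\<^sub>0_def ess_eq_def)
    ultimately show ?thesis
      using A\<^sub>0 eq That_eq by blast
  qed
qed

end
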